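(* Let $K\subset\mathbb{R}$ be an interval with interior $K^0$, let $\varphi:K\to\mathbb{R}$ be continuous with $0\le\varphi\le\frac{\pi}{2}$, and let $a,b\in K^0$ with $a<a+e^{i\varphi}(b-a)$ and $[a,a+e^{i\varphi}(b-a)]\subset K$. Let $f:K\to(0,\infty)$ be twice differentiable on $K^0$ with $f''$ integrable on $[a,a+e^{i\varphi}(b-a)]$. Let $p\in\mathbb{R}$ with $p>1$. If $|f''|^{\frac{p}{p-1}}$ is a log-$\varphi$-convex function on $K^0$ and $|f''(a)|\ne|f''(b)|$, then $$\left|\frac{1}{e^{i\varphi}(b-a)}\int_a^{a+e^{i\varphi}(b-a)}f(x)\,dx-\frac{f(a)+f(a+e^{i\varphi}(b-a))}{2}\right|\le\frac{e^{2i\varphi}(b-a)^2}{8}\left(\frac{\sqrt{\pi}}{2}\right)^{\frac1p}\left(\frac{\Gamma(p+1)}{\Gamma(\frac32+p)}\right)^{\frac1p}\left(\frac{p-1}{p}\right)^{\frac{p-1}{p}}\left(\frac{|f''(b)|^{\frac{p}{p-1}}-|f''(a)|^{\frac{p}{p-1}}}{\log|f''(b)|-\log|f''(a)|}\right)^{\frac{p-1}{p}}.$$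
   Context: Here $i$ is the imaginary unit and $\Gamma$ is the Gamma function. In an expression $u+te^{i\varphi}(v-u)$ the argument of $\varphi$ is suppressed and $\varphi$ is read as its value at the base point $u$; thus $a+e^{i\varphi}(b-a)$ uses $\varphi=\varphi(a)$. Since $a+e^{i\varphi}(b-a)$ is an endpoint of a real interval, it is understood to be a real number. A set $S$ is $\varphi$-convex if $u+te^{i\varphi}(v-u)\in S$ for all $u,v\in S$ and $t\in[0,1]$. A function $g$ on a $\varphi$-convex set $S$ with $g>0$ is log-$\varphi$-convex (logarithmic $\varphi$-convex) if $g(u+te^{i\varphi}(v-u))\le g(u)^{1-t}g(v)^t$ for all $u,v\in S$, $t\in[0,1]$. Saying that $g$ is log-$\varphi$-convex on a set includes that the set is $\varphi$-convex and that $g>0$ on it. *)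

theory Defs
  imports "HOL-Analysis.Analysis"
begin

text \<open>
  The point \<open>u + t * exp (\<i> * \<phi> u) * (v - u)\<close> is a priori a complex number even for real \<open>u\<close>, \<open>v\<close>;
  \<open>\<phi>\<close> is always evaluated at the base point \<open>u\<close>.
\<close>

definition phi_point :: "(real \<Rightarrow> real) \<Rightarrow> real \<Rightarrow> real \<Rightarrow> real \<Rightarrow> complex" where
  "phi_point \<phi> u v t =
     complex_of_real u + complex_of_real t * exp (\<i> * complex_of_real (\<phi> u)) * complex_of_real (v - u)"

text \<open>Membership in the real set \<open>S\<close> includes that the point is a real number.\<close>

definition phi_convex :: "(real \<Rightarrow> real) \<Rightarrow> real set \<Rightarrow> bool" where
  "phi_convex \<phi> S \<longleftrightarrow>
     (\<forall>u\<in>S. \<forall>v\<in>S. \<forall>t\<in>{0..1}. phi_point \<phi> u v t \<in> complex_of_real ` S)"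

text \<open>The use of \<open>Re\<close> is harmless: \<open>phi_convex\<close> makes the argument of \<open>g\<close> real.\<close>

definition log_phi_convex_on :: "(real \<Rightarrow> real) \<Rightarrow> real set \<Rightarrow> (real \<Rightarrow> real) \<Rightarrow> bool" where
  "log_phi_convex_on \<phi> S g \<longleftrightarrow>
     phi_convex \<phi> S \<and> (\<forall>x\<in>S. g x > 0) \<and>
     (\<forall>u\<in>S. \<forall>v\<in>S. \<forall>t\<in>{0..1}.
        g (Re (phi_point \<phi> u v t)) \<le> g u powr (1 - t) * g v powr t)"

end

theory Submission
  imports Defs
begin

text \<open>
  Since \<open>a + exp (\<i> * \<phi> a) * (b - a)\<close> is real and \<open>0 \<le> \<phi> a \<le> pi / 2\<close>, the angle \<open>\<phi> a\<close> vanishes, so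
  the statement concerns the interval \<open>[a, b]\<close>. There the trapezoid error is an integral of \<open>f''\<close>
  against \<open>(x - a) * (b - x)\<close>; the pointwise log-convex bound on \<open>f''\<close> is inserted first, so that
  Hoelder's inequality is only needed for explicit continuous functions. The two resulting integrals
  are \<open>Beta (p + 1) (p + 1)\<close>, reduced by Legendre duplication, and a logarithmic mean.
\<close>

text \<open>Integration by parts twice, packed into the antiderivative \<open>?F\<close>: its
  derivative is the weighted \<open>f''\<close> term plus \<open>2 * f\<close>. The weight vanishes
  at both ends, so only the values of \<open>f\<close> survive in
  \<open>?F b - ?F a\<close>.\<close>

lemma trapezoid_has_integral:
  fixes f f' f'' :: "real \<Rightarrow> real"
  assumes "a \<le> b"
    and f: "\<And>x. x \<in> {a..b} \<Longrightarrow> (f has_real_derivative f' x) (at x within {a..b})"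
    and f': "\<And>x. x \<in> {a..b} \<Longrightarrow> (f' has_real_derivative f'' x) (at x within {a..b})"
  shows "((\<lambda>x. (x - a) * (b - x) * f'' x) has_integral
           (b - a) * (f a + f b) - 2 * integral {a..b} f) {a..b}"
proof -
  let ?F = "\<lambda>x. (x - a) * (b - x) * f' x - (a + b - 2 * x) * f x"
  have "((\<lambda>x. (x - a) * (b - x) * f'' x + 2 * f x) has_integral ?F b - ?F a) {a..b}"
    using \<open>a \<le> b\<close>
  proof (rule fundamental_theorem_of_calculus)
    fix x assume x: "x \<in> {a..b}"
    show "(?F has_vector_derivative (x - a) * (b - x) * f'' x + 2 * f x) (at x within {a..b})"
      unfolding has_real_derivative_iff_has_vector_derivative [symmetric]
      by (rule derivative_eq_intros f[OF x] f'[OF x] refl | simp add: algebra_simps)+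
  qed
  moreover have "continuous_on {a..b} f"
    using f by (meson DERIV_continuous continuous_on_eq_continuous_within)
  then have "(f has_integral integral {a..b} f) {a..b}"
    using integrable_continuous_real integrable_integral by blast
  then have "((\<lambda>x. 2 * f x) has_integral 2 * integral {a..b} f) {a..b}"
    by (rule has_integral_mult_right)
  ultimately have "((\<lambda>x. (x - a) * (b - x) * f'' x + 2 * f x - 2 * f x) has_integral
      ?F b - ?F a - 2 * integral {a..b} f) {a..b}"
    by (rule has_integral_diff)
  then show ?thesis
    by (simp add: algebra_simps)
qed

text \<open>Normalising \<open>u\<close> by \<open>U powr (1 / p)\<close> and \<open>v\<close> by
  \<open>V powr (1 / q)\<close>, Young's inequality holds pointwise. Integrating it gives
  \<open>1 / p + 1 / q = 1\<close> times the scaling constant \<open>C\<close>.\<close>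

lemma Holder_integral:
  fixes u v :: "real \<Rightarrow> real"
  assumes pq: "p > 1" "q > 1" "1 / p + 1 / q = 1"
    and nonneg: "\<And>x. x \<in> S \<Longrightarrow> u x \<ge> 0" "\<And>x. x \<in> S \<Longrightarrow> v x \<ge> 0"
    and U: "((\<lambda>x. u x powr p) has_integral U) S" "U > 0"
    and V: "((\<lambda>x. v x powr q) has_integral V) S" "V > 0"
    and uv: "(\<lambda>x. u x * v x) integrable_on S"
  shows "integral S (\<lambda>x. u x * v x) \<le> U powr (1 / p) * V powr (1 / q)"
proof -
  define C where "C = U powr (1 / p) * V powr (1 / q)"
  have C: "C > 0"
    using U V by (simp add: C_def)
  have "u x * v x \<le> C * (u x powr p / (p * U) + v x powr q / (q * V))" if "x \<in> S" for x
  proof -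
    have "u x / U powr (1 / p) * (v x / V powr (1 / q))
        \<le> (u x / U powr (1 / p)) powr p / p + (v x / V powr (1 / q)) powr q / q"
      using pq nonneg that by (intro Youngs_inequality) auto
    also have "\<dots> = u x powr p / (p * U) + v x powr q / (q * V)"
      using pq U V nonneg[OF that] by (simp add: powr_divide powr_powr mult.commute)
    finally show ?thesis
      using C unfolding C_def by (simp add: field_simps)
  qed
  moreover have rhs: "((\<lambda>x. C * (u x powr p / (p * U) + v x powr q / (q * V)))
      has_integral C * (U / (p * U) + V / (q * V))) S"
    by (intro has_integral_mult_right has_integral_add has_integral_divide U V)
  ultimately have "integral S (\<lambda>x. u x * v x) \<le> C * (U / (p * U) + V / (q * V))"
    using has_integral_le[OF integrable_integral[OF uv] rhs] by blast
  also have "\<dots> = C"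
    using pq U V by simp
  finally show ?thesis
    by (simp add: C_def)
qed

lemma Gamma_legendre_duplication_real:
  fixes x :: real
  assumes "x > 0"
  shows "Gamma x * Gamma (x + 1 / 2) = 2 powr (1 - 2 * x) * sqrt pi * Gamma (2 * x)"
proof -
  \<comment> \<open>These two conditions keep \<open>x\<close> and \<open>x + 1 / 2\<close> off the
    poles of Gamma, as the complex duplication formula demands.\<close>
  have "complex_of_real x \<notin> \<int>\<^sub>\<le>\<^sub>0" "complex_of_real (x + 1 / 2) \<notin> \<int>\<^sub>\<le>\<^sub>0"
    using assms by (auto simp only: of_real_in_nonpos_Ints_iff dest: nonpos_Ints_nonpos)
  then have "complex_of_real (Gamma x * Gamma (x + 1 / 2))
      = complex_of_real (exp ((1 - 2 * x) * ln 2) * sqrt pi * Gamma (2 * x))"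
    using Gamma_legendre_duplication[of "complex_of_real x"]
    by (simp flip: Gamma_complex_of_real exp_of_real)
  then show ?thesis
    by (simp only: of_real_eq_iff) (simp add: powr_def)
qed

text \<open>The left side is \<open>Gamma (p + 1)\<close> squared over
  \<open>Gamma (2 * p + 2)\<close>. Duplication at \<open>p + 1\<close> rewrites one factor
  \<open>Gamma (p + 1)\<close> over that denominator.\<close>

lemma Beta_diagonal:
  fixes p :: real
  assumes "p > -1"
  shows "Beta (p + 1) (p + 1) = 4 powr - p * (sqrt pi / 2) * (Gamma (p + 1) / Gamma (3 / 2 + p))"
proof -
  have pos: "Gamma (p + 1) > 0" "Gamma (3 / 2 + p) > 0" "Gamma (2 * p + 2) > 0"
    using assms by (auto intro: Gamma_real_pos)
  have "Gamma (p + 1) * Gamma (3 / 2 + p) = 2 powr (- 1 - 2 * p) * sqrt pi * Gamma (2 * p + 2)"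
    using Gamma_legendre_duplication_real[of "p + 1"] assms by (simp add: algebra_simps)
  moreover have "(2::real) powr (- 1 - 2 * p) = 4 powr - p / 2"
    using powr_powr[of 2 2 "- p"] by (simp add: powr_diff powr_minus field_simps)
  ultimately have "Gamma (p + 1) / Gamma (2 * p + 2) = 4 powr - p * (sqrt pi / 2) / Gamma (3 / 2 + p)"
    using pos by (simp add: field_simps)
  then have "Gamma (p + 1) * (Gamma (p + 1) / Gamma (2 * p + 2))
      = Gamma (p + 1) * (4 powr - p * (sqrt pi / 2) / Gamma (3 / 2 + p))"
    by (rule arg_cong)
  then show ?thesis
    by (simp add: Beta_def mult_ac algebra_simps)
qed

text \<open>The integrand is the exponential \<open>M * exp (t * k)\<close> with
  \<open>k = ln N - ln M\<close>, nonzero because \<open>M\<close> and \<open>N\<close> differ. The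
  value is the logarithmic mean of \<open>M\<close> and \<open>N\<close>.\<close>

lemma has_integral_powr_interpolation:
  fixes M N :: real
  assumes "M > 0" "N > 0" "M \<noteq> N"
  shows "((\<lambda>t. M powr (1 - t) * N powr t) has_integral (N - M) / (ln N - ln M)) {0..1}"
proof -
  define k where "k = ln N - ln M"
  have "k \<noteq> 0"
    using assms by (simp add: k_def)
  have eq: "M powr (1 - t) * N powr t = M * exp (t * k)" for t
    using assms by (simp add: powr_def k_def exp_diff exp_minus algebra_simps)
  have "((\<lambda>t. M * exp (t * k)) has_integral M * exp (1 * k) / k - M * exp (0 * k) / k) {0..1}"
    using \<open>k \<noteq> 0\<close>
    by (intro fundamental_theorem_of_calculus)
      (auto intro!: derivative_eq_intros simp flip: has_real_derivative_iff_has_vector_derivative)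
  moreover have "M * exp k = N"
    using assms by (simp add: k_def exp_diff)
  ultimately show ?thesis
    by (simp add: eq diff_divide_distrib flip: k_def)
qed

text \<open>This is the case \<phi> = 0 of the estimate. The convexity bound \<open>lc\<close>
  compares with the end points only, and the substitution \<open>x = a + t * (b - a)\<close> makes
  its parameter \<open>t\<close> the integration variable.\<close>

lemma trapezoid_log_convex_bound:
  fixes f f' f'' :: "real \<Rightarrow> real"
  assumes "a < b" and p: "p > 1"
    and f: "\<And>x. x \<in> {a..b} \<Longrightarrow> (f has_real_derivative f' x) (at x within {a..b})"
    and f': "\<And>x. x \<in> {a..b} \<Longrightarrow> (f' has_real_derivative f'' x) (at x within {a..b})"
    and ne: "f'' a \<noteq> 0" "f'' b \<noteq> 0" "\<bar>f'' a\<bar> \<noteq> \<bar>f'' b\<bar>"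
    and lc: "\<And>t. t \<in> {0..1} \<Longrightarrow> \<bar>f'' (a + t * (b - a))\<bar> powr (p / (p - 1))
       \<le> (\<bar>f'' a\<bar> powr (p / (p - 1))) powr (1 - t) * (\<bar>f'' b\<bar> powr (p / (p - 1))) powr t"
  shows "\<bar>1 / (b - a) * integral {a..b} f - (f a + f b) / 2\<bar>
     \<le> (b - a)\<^sup>2 / 8 * (sqrt pi / 2) powr (1 / p)
        * (Gamma (p + 1) / Gamma (3 / 2 + p)) powr (1 / p)
        * ((p - 1) / p) powr ((p - 1) / p)
        * ((\<bar>f'' b\<bar> powr (p / (p - 1)) - \<bar>f'' a\<bar> powr (p / (p - 1)))
            / (ln \<bar>f'' b\<bar> - ln \<bar>f'' a\<bar>)) powr ((p - 1) / p)"
proof -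
  define d q where "d = b - a" and "q = p / (p - 1)"
  have d: "d > 0" and q: "q > 1" and pq: "1 / p + 1 / q = 1" and q': "1 / q = (p - 1) / p"
    using \<open>a < b\<close> p by (auto simp: d_def q_def field_simps)
  define M N where "M = \<bar>f'' a\<bar> powr q" and "N = \<bar>f'' b\<bar> powr q"
  have pos: "M > 0" "N > 0"
    using ne by (auto simp: M_def N_def)
  have lnMN: "ln M = q * ln \<bar>f'' a\<bar>" "ln N = q * ln \<bar>f'' b\<bar>"
    using ne by (auto simp: M_def N_def ln_powr)
  have "ln \<bar>f'' a\<bar> \<noteq> ln \<bar>f'' b\<bar>"
    using ne by simp
  then have "ln M \<noteq> ln N"
    using q by (simp add: lnMN)
  then have MN: "M \<noteq> N"
    by auto
  \<comment> \<open>\<open>L\<close> is the quotient of the claim, \<open>V\<close> the logarithmic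
    mean of \<open>M\<close> and \<open>N\<close>. Their denominators differ by the factor
    \<open>q\<close>, which is the source of the constant \<open>(p - 1) / p\<close>.\<close>
  define L where "L = (N - M) / (ln \<bar>f'' b\<bar> - ln \<bar>f'' a\<bar>)"
  define V where "V = (N - M) / (ln N - ln M)"
  have V: "V > 0"
    unfolding V_def using pos MN by (cases "M < N") (auto intro!: divide_pos_pos divide_neg_neg)
  have VL: "V = 1 / q * L"
    by (simp add: V_def L_def lnMN flip: right_diff_distrib)
  have L: "L > 0"
    using V VL q by (simp add: zero_less_divide_iff)
  define G where "G = Gamma (p + 1) / Gamma (3 / 2 + p)"
  have G: "G > 0"
    using p by (auto simp: G_def intro!: divide_pos_pos Gamma_real_pos)
  define U where "U = 4 powr - p * (sqrt pi / 2) * G"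
  have U: "U > 0"
    using G by (simp add: U_def)
  \<comment> \<open>\<open>u\<close> is the trapezoid weight rescaled to the unit interval and
    \<open>v\<close> the majorant of the second derivative. Their powers with exponents
    \<open>p\<close> and \<open>q\<close> have the explicit integrals \<open>U\<close> and
    \<open>V\<close>.\<close>
  define u v :: "real \<Rightarrow> real"
    where "u = (\<lambda>t. t * (1 - t))" and "v = (\<lambda>t. (M powr (1 - t) * N powr t) powr (1 / q))"
  have "((\<lambda>t. t powr p * (1 - t) powr p) has_integral U) {0..1}"
    using has_integral_Beta_real[of "p + 1" "p + 1"] p by (simp add: Beta_diagonal U_def G_def)
  then have uU: "((\<lambda>t. u t powr p) has_integral U) {0..1}"
    by (rule has_integral_eq[rotated]) (auto simp: u_def powr_mult)
  have vV: "((\<lambda>t. v t powr q) has_integral V) {0..1}"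
    using has_integral_powr_interpolation[OF pos MN] q by (simp add: v_def V_def powr_powr)
  have "continuous_on {0..1} (\<lambda>t. u t * v t)"
    unfolding u_def v_def using pos by (auto intro!: continuous_intros)
  then have uv: "(\<lambda>t. u t * v t) integrable_on {0..1}"
    by (rule integrable_continuous_real)

  \<comment> \<open>\<open>I\<close> is twice the trapezoid error, up to sign. The substitution
    divides the integral identity by \<open>d\<close>, and the weight becomes
    \<open>d\<^sup>2 * u t\<close>.\<close>
  define I where "I = f a + f b - 2 * integral {a..b} f / d"
  have "((\<lambda>t. (d *\<^sub>R t + a - a) * (b - (d *\<^sub>R t + a)) * f'' (d *\<^sub>R t + a)) has_integral
      (d * (f a + f b) - 2 * integral {a..b} f) /\<^sub>R d ^ DIM(real))
      (cbox ((a - a) /\<^sub>R d) ((b - a) /\<^sub>R d))"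
    using trapezoid_has_integral[of a b f f' f''] \<open>a < b\<close> f f' d
    by (intro has_integral_affinity') (auto simp: d_def)
  then have "((\<lambda>t. d * t * (b - (d * t + a)) * f'' (d * t + a)) has_integral I) {0..1}"
    using d by (simp add: I_def d_def[symmetric] field_simps)
  then have I: "((\<lambda>t. d\<^sup>2 * (u t * f'' (a + t * d))) has_integral I) {0..1}"
    by (rule has_integral_eq[rotated]) (simp add: u_def d_def power2_eq_square algebra_simps)
  have "norm (integral {0..1} (\<lambda>t. d\<^sup>2 * (u t * f'' (a + t * d)))) \<le> integral {0..1} (\<lambda>t. d\<^sup>2 * (u t * v t))"
  proof (rule integral_norm_bound_integral)
    fix t :: real assume t: "t \<in> {0..1}"
    \<comment> \<open>The convexity bound concerns the \<open>q\<close>-th power, so a monotone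
      \<open>q\<close>-th root is taken.\<close>
    have "\<bar>f'' (a + t * d)\<bar> = (\<bar>f'' (a + t * d)\<bar> powr q) powr (1 / q)"
      using q by (simp add: powr_powr)
    also have "\<dots> \<le> v t"
      using lc[OF t] q unfolding v_def M_def N_def q_def[symmetric] d_def[symmetric]
      by (intro powr_mono2) auto
    finally show "norm (d\<^sup>2 * (u t * f'' (a + t * d))) \<le> d\<^sup>2 * (u t * v t)"
      using t by (auto simp: u_def abs_mult intro!: mult_left_mono)
  qed (use I uv in \<open>auto intro: integrable_on_mult_right\<close>)
  then have "\<bar>I\<bar> \<le> d\<^sup>2 * integral {0..1} (\<lambda>t. u t * v t)"
    using integral_unique[OF I] by simp
  also have "\<dots> \<le> d\<^sup>2 * (U powr (1 / p) * V powr (1 / q))"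
    using Holder_integral[OF p q pq _ _ uU U vV V uv] by (intro mult_left_mono) (auto simp: u_def v_def)
  \<comment> \<open>The root of \<open>4 powr - p\<close> is 1/4; halving \<open>I\<close> then
    yields the factor 1/8.\<close>
  also have "U powr (1 / p) = 1 / 4 * (sqrt pi / 2) powr (1 / p) * G powr (1 / p)"
    using G p by (simp only: U_def powr_mult powr_powr) (simp add: powr_minus_divide)
  also have "V powr (1 / q) = ((p - 1) / p) powr ((p - 1) / p) * L powr ((p - 1) / p)"
    by (simp only: VL q' powr_mult)
  finally have "\<bar>I\<bar> / 2 \<le> d\<^sup>2 / 8 * (sqrt pi / 2) powr (1 / p) * G powr (1 / p)
      * ((p - 1) / p) powr ((p - 1) / p) * L powr ((p - 1) / p)"
    by simp
  moreover have "\<bar>1 / d * integral {a..b} f - (f a + f b) / 2\<bar> = \<bar>I\<bar> / 2"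
    by (simp add: I_def abs_if field_simps)
  ultimately show ?thesis
    by (simp only: d_def L_def G_def M_def N_def q_def)
qed

text \<open>The imaginary part of the right side is \<open>sin \<theta> * y\<close>, which must
  vanish, whereas the sine is positive for 0 < \<theta> \<le> pi / 2.\<close>

lemma real_rotation_trivial:
  fixes \<theta> x y :: real
  assumes "complex_of_real x = exp (\<i> * complex_of_real \<theta>) * complex_of_real y"
    and "y \<noteq> 0" "0 \<le> \<theta>" "\<theta> \<le> pi / 2"
  shows "\<theta> = 0"
proof (rule ccontr)
  assume "\<theta> \<noteq> 0"
  then have "sin \<theta> > 0"
    using assms pi_gt_zero by (intro sin_gt_zero) linarith+
  moreover have "Im (exp (\<i> * complex_of_real \<theta>) * complex_of_real y) = 0"
    using assms(1) by (metis Im_complex_of_real)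
  ultimately show False
    using \<open>y \<noteq> 0\<close> by (simp add: Im_exp)
qed

theorem theorem9:
  fixes K :: "real set" and \<phi> f :: "real \<Rightarrow> real" and a b c p :: real
  assumes "is_interval K"
    and "continuous_on K \<phi>"
    and "\<forall>x\<in>K. 0 \<le> \<phi> x \<and> \<phi> x \<le> pi / 2"
    and "a \<in> interior K" and "b \<in> interior K"
    and "complex_of_real c
           = complex_of_real a + exp (\<i> * complex_of_real (\<phi> a)) * complex_of_real (b - a)"
    and "a < c"
    and "{a..c} \<subseteq> K"
    and "\<forall>x\<in>K. f x > 0"
    and "f differentiable_on interior K"
    and "deriv f differentiable_on interior K"
    and "deriv (deriv f) absolutely_integrable_on {a..c}"
    and "p > 1"
    and "log_phi_convex_on \<phi> (interior K) (\<lambda>x. \<bar>deriv (deriv f) x\<bar> powr (p / (p - 1)))"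
    and "\<bar>deriv (deriv f) a\<bar> \<noteq> \<bar>deriv (deriv f) b\<bar>"
  shows "cmod (1 / (exp (\<i> * complex_of_real (\<phi> a)) * complex_of_real (b - a))
                 * complex_of_real (integral {a..c} f)
               - complex_of_real ((f a + f c) / 2))
         \<le> Re (exp (2 * \<i> * complex_of_real (\<phi> a)) * complex_of_real ((b - a)\<^sup>2)) / 8
           * (sqrt pi / 2) powr (1 / p)
           * (Gamma (p + 1) / Gamma (3 / 2 + p)) powr (1 / p)
           * ((p - 1) / p) powr ((p - 1) / p)
           * ((\<bar>deriv (deriv f) b\<bar> powr (p / (p - 1)) - \<bar>deriv (deriv f) a\<bar> powr (p / (p - 1)))
              / (ln \<bar>deriv (deriv f) b\<bar> - ln \<bar>deriv (deriv f) a\<bar>)) powr ((p - 1) / p)"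
proof -
  let ?K = "interior K" and ?f'' = "deriv (deriv f)"
  have "a \<in> K"
    using assms(4) interior_subset by blast
  have ab: "complex_of_real (c - a) = exp (\<i> * complex_of_real (\<phi> a)) * complex_of_real (b - a)"
    using assms(6) by simp
  \<comment> \<open>Equal points would give equal values of \<open>\<bar>?f'' a\<bar>\<close> and
    \<open>\<bar>?f'' b\<bar>\<close>.\<close>
  have "b \<noteq> a"
    using assms(15) by auto
  then have \<phi>: "\<phi> a = 0"
    using real_rotation_trivial[OF ab] assms(3) \<open>a \<in> K\<close> by simp
  then have "c = b"
    using ab by (simp flip: of_real_diff)
  have "is_interval ?K"
    using assms(1) by (simp add: is_interval_convex_1 convex_interior)
  then have sub: "{a..b} \<subseteq> ?K"
    using assms(4,5) by (metis interval_subset_is_interval box_real(2) empty_subsetI)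
  \<comment> \<open>\<open>deriv\<close> is a choice operator; differentiability on the open set
    \<open>?K\<close> makes it the actual derivative at every point of
    \<open>[a, b]\<close>.\<close>
  have der: "(g has_real_derivative deriv g x) (at x within {a..b})"
    if "g differentiable_on ?K" "x \<in> {a..b}" for g x
  proof -
    have "g field_differentiable at x"
      using that sub by (metis differentiable_on_def at_within_interior interior_interior subsetD
          field_differentiable_def real_differentiable_def)
    then show ?thesis
      using DERIV_deriv_iff_field_differentiable has_field_derivative_at_within by blast
  qed
  have lc: "\<bar>?f'' (Re (phi_point \<phi> a b t))\<bar> powr (p / (p - 1))
      \<le> (\<bar>?f'' a\<bar> powr (p / (p - 1))) powr (1 - t) * (\<bar>?f'' b\<bar> powr (p / (p - 1))) powr t"
    if "t \<in> {0..1}" for t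
    using assms(4,5,14) that unfolding log_phi_convex_on_def by blast
  \<comment> \<open>Positivity is part of log-\<phi>-convexity. As \<open>0 powr r = 0\<close>, it
    forces the second derivative to be nonzero at \<open>a\<close> and \<open>b\<close>, so the
    logarithms in the bound are genuine.\<close>
  have "\<bar>?f'' x\<bar> powr (p / (p - 1)) > 0" if "x \<in> ?K" for x
    using assms(14) that unfolding log_phi_convex_on_def by blast
  then have "?f'' a \<noteq> 0" "?f'' b \<noteq> 0"
    using assms(4,5) by fastforce+
  then have main: "\<bar>1 / (b - a) * integral {a..b} f - (f a + f b) / 2\<bar>
     \<le> (b - a)\<^sup>2 / 8 * (sqrt pi / 2) powr (1 / p)
        * (Gamma (p + 1) / Gamma (3 / 2 + p)) powr (1 / p)
        * ((p - 1) / p) powr ((p - 1) / p)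
        * ((\<bar>?f'' b\<bar> powr (p / (p - 1)) - \<bar>?f'' a\<bar> powr (p / (p - 1)))
            / (ln \<bar>?f'' b\<bar> - ln \<bar>?f'' a\<bar>)) powr ((p - 1) / p)"
    using assms(7,13,15) \<open>c = b\<close> der[OF assms(10)] der[OF assms(11)] lc
    by (intro trapezoid_log_convex_bound[where f' = "deriv f"]) (auto simp: phi_point_def \<phi>)
  have "1 / (exp (\<i> * complex_of_real (\<phi> a)) * complex_of_real (b - a))
                 * complex_of_real (integral {a..c} f) - complex_of_real ((f a + f c) / 2)
      = complex_of_real (1 / (b - a) * integral {a..b} f - (f a + f b) / 2)"
    by (simp add: \<phi> \<open>c = b\<close>)
  moreover have "Re (exp (2 * \<i> * complex_of_real (\<phi> a)) * complex_of_real ((b - a)\<^sup>2)) = (b - a)\<^sup>2"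
    by (simp only: \<phi>) simp
  ultimately show ?thesis
    using main by (simp only: norm_of_real)
qed

end
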